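(* Let $n>1$ be an integer, let $X$ be an $n$-dimensional topological manifold and let $Y\subset X$ be an $(n-1)$-dimensional submanifold. Suppose that $X$ and $Y$ are both connected and non-empty, that $Y$ is a closed subset of $X$, and that $\operatorname{Hom}(H_1(X),\mathbb{Z}/2\mathbb{Z})=0$. If $y\in Y$, then $(X\setminus Y)\cup\{y\}$ is pathwise connected.
   Context: Manifolds are topological manifolds (without boundary). An $(n-1)$-dimensional submanifold $Y$ of $X$ is a subset which, with the subspace topology, is an $(n-1)$-dimensional topological manifold; no smoothness or local flatness is assumed. $H_1(X)$ is the first singular homology group with integer coefficients, and $\operatorname{Hom}$ denotes group homomorphisms. $(X\setminus Y)\cup\{y\}$ carries the subspace topology from $X$. *)

theory Defs
  imports "HOL-Analysis.Analysis" "HOL-Homology.Homology"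
begin

definition topological_manifold :: "nat \<Rightarrow> 'a topology \<Rightarrow> bool" where
  "topological_manifold n X \<longleftrightarrow>
     Hausdorff_space X \<and> second_countable X \<and>
     (\<forall>x \<in> topspace X. \<exists>U V. openin X U \<and> x \<in> U \<and> openin (Euclidean_space n) V \<and>
        subtopology X U homeomorphic_space subtopology (Euclidean_space n) V)"

text \<open>No local flatness: only the subspace topology on \<open>Y\<close> matters.\<close>

definition submanifold :: "nat \<Rightarrow> 'a topology \<Rightarrow> 'a set \<Rightarrow> bool" where
  "submanifold k X Y \<longleftrightarrow> Y \<subseteq> topspace X \<and> topological_manifold k (subtopology X Y)"

text \<open>The group of homomorphisms under pointwise multiplication. Members of \<^const>\<open>hom\<close> are
  unconstrained outside the carrier; taking them extensional makes each homomorphism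
  occur exactly once.\<close>

definition Hom_group :: "('a, 'c) monoid_scheme \<Rightarrow> ('b, 'd) monoid_scheme \<Rightarrow> ('a \<Rightarrow> 'b) monoid" where
  "Hom_group G A =
     \<lparr>carrier = hom G A \<inter> extensional (carrier G),
      monoid.mult = (\<lambda>f g. \<lambda>x\<in>carrier G. f x \<otimes>\<^bsub>A\<^esub> g x),
      one = (\<lambda>x\<in>carrier G. \<one>\<^bsub>A\<^esub>)\<rparr>"

lemma group_Hom_group:
  assumes "group G" "comm_group A"
  shows "group (Hom_group G A)"
proof -
  interpret G: group G by fact
  interpret A: comm_group A by fact
  show ?thesis
  proof (rule groupI)
    fix f g assume "f \<in> carrier (Hom_group G A)" "g \<in> carrier (Hom_group G A)"
    then show "f \<otimes>\<^bsub>Hom_group G A\<^esub> g \<in> carrier (Hom_group G A)"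
      by (auto simp: Hom_group_def hom_def Pi_iff A.m_ac)
  next
    show "\<one>\<^bsub>Hom_group G A\<^esub> \<in> carrier (Hom_group G A)"
      by (auto simp: Hom_group_def hom_def)
  next
    fix f g h
    assume "f \<in> carrier (Hom_group G A)" "g \<in> carrier (Hom_group G A)" "h \<in> carrier (Hom_group G A)"
    then show "f \<otimes>\<^bsub>Hom_group G A\<^esub> g \<otimes>\<^bsub>Hom_group G A\<^esub> h = f \<otimes>\<^bsub>Hom_group G A\<^esub> (g \<otimes>\<^bsub>Hom_group G A\<^esub> h)"
      by (auto simp: Hom_group_def hom_def Pi_iff A.m_assoc intro!: restrict_ext)
  next
    fix f assume "f \<in> carrier (Hom_group G A)"
    then show "\<one>\<^bsub>Hom_group G A\<^esub> \<otimes>\<^bsub>Hom_group G A\<^esub> f = f"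
      by (auto simp: Hom_group_def hom_def Pi_iff extensional_def restrict_def fun_eq_iff)
  next
    fix f assume f: "f \<in> carrier (Hom_group G A)"
    let ?g = "\<lambda>x\<in>carrier G. inv\<^bsub>A\<^esub> (f x)"
    have "?g \<in> carrier (Hom_group G A)"
      using f by (auto simp: Hom_group_def hom_def Pi_iff A.inv_mult)
    moreover have "?g \<otimes>\<^bsub>Hom_group G A\<^esub> f = \<one>\<^bsub>Hom_group G A\<^esub>"
      using f by (auto simp: Hom_group_def hom_def Pi_iff intro!: restrict_ext)
    ultimately show "\<exists>g\<in>carrier (Hom_group G A). g \<otimes>\<^bsub>Hom_group G A\<^esub> f = \<one>\<^bsub>Hom_group G A\<^esub>"
      by blast
  qed
qed

lemma trivial_Hom_group_iff:
  assumes "group G" "comm_group A"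
  shows "trivial_group (Hom_group G A) \<longleftrightarrow> (\<forall>h \<in> hom G A. \<forall>x \<in> carrier G. h x = \<one>\<^bsub>A\<^esub>)"
    (is "?lhs \<longleftrightarrow> ?rhs")
proof -
  interpret G: group G by fact
  have triv: "?lhs \<longleftrightarrow> carrier (Hom_group G A) \<subseteq> {\<one>\<^bsub>Hom_group G A\<^esub>}"
    by (rule group.trivial_group_subset[OF group_Hom_group[OF assms]])
  show ?thesis
  proof
    assume L: ?lhs
    show ?rhs
    proof (intro ballI)
      fix h x assume h: "h \<in> hom G A" and x: "x \<in> carrier G"
      have "restrict h (carrier G) \<in> carrier (Hom_group G A)"
        using h by (auto simp: Hom_group_def hom_def)
      then have "restrict h (carrier G) = (\<lambda>x\<in>carrier G. \<one>\<^bsub>A\<^esub>)"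
        using L triv by (auto simp: Hom_group_def)
      then show "h x = \<one>\<^bsub>A\<^esub>"
        using x by (metis restrict_apply')
    qed
  next
    assume R: ?rhs
    have "h = (\<lambda>x\<in>carrier G. \<one>\<^bsub>A\<^esub>)" if "h \<in> hom G A" "h \<in> extensional (carrier G)" for h
      using that R by (intro extensionalityI[of _ "carrier G"]) auto
    then show ?lhs
      unfolding triv by (auto simp: Hom_group_def)
  qed
qed

end

theory Submission
  imports Defs
begin

text \<open>
  The argument is local. Key claim: for every
  neighbourhood \<open>U\<close> of a point of \<open>Y\<close> there is a neighbourhood \<open>W\<close> of it such that each point of
  \<open>W - Y\<close> can be joined inside \<open>U - Y\<close> to points arbitrarily close to any \<open>q \<in> Y \<inter> W\<close>. In a
  Euclidean chart, \<open>Y\<close> is a closed set homeomorphic to an open subset of \<open>\<real>\<^sup>n\<^sup>-\<^sup>1\<close>. Let \<open>Z\<^sub>0\<close> be its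
  path component through the given point and \<open>Z\<^sub>1\<close> the rest. Connectedness of complements of closed
  sets in \<open>\<real>\<^sup>n\<close> depends only on their homeomorphism type, so \<open>Z\<^sub>0\<close> minus a piece near \<open>q\<close> may be
  replaced by a graph with a hole, which does not separate. Hence the point reaches \<open>q\<close> off \<open>Z\<^sub>0\<close>, also
  off \<open>Z\<^sub>1\<close> by staying in a small neighbourhood, and therefore off \<open>Z\<^sub>0 \<union> Z\<^sub>1\<close> by Janiszewski's theorem.

  By the claim, the closure of a path component of \<open>X - Y\<close> meets \<open>Y\<close> in an open and closed set,
  which is nonempty as \<open>X\<close> is connected, so it contains \<open>Y\<close>. Applying the claim to
  neighbourhoods shrinking to \<open>y\<close> gives paths whose infinite concatenation converges to \<open>y\<close>.
\<close>

subsection \<open>Separation by disjoint closed sets\<close>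

lemma ivt_avoid_greater:
  fixes h :: "real \<Rightarrow> real"
  assumes "continuous_on {0..1} h" "\<And>t. t \<in> {0..1} \<Longrightarrow> h t \<noteq> a" "h 0 > a"
  shows "h 1 > a"
proof (rule ccontr)
  assume "\<not> h 1 > a"
  then obtain t where "0 \<le> t" "t \<le> 1" "h t = a"
    using IVT2'[of h 1 a 0] assms by force
  with assms(2) show False by auto
qed

lemma ivt_avoid_less:
  fixes h :: "real \<Rightarrow> real"
  assumes "continuous_on {0..1} h" "\<And>t. t \<in> {0..1} \<Longrightarrow> h t \<noteq> a" "h 0 < a"
  shows "h 1 < a"
  using ivt_avoid_greater[of "\<lambda>t. - h t" "- a"] assms by (auto intro: continuous_on_minus)

text \<open>A square form of Janiszewski's theorem, by winding: if \<open>S \<union> T\<close>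
  separated the left side from the right side, one could build a circle-valued map on the square
  that winds once around the circle along the boundary, although a map on a contractible set lifts
  to the line.\<close>

lemma path_component_square_Diff_Un:
  fixes S T :: "(real \<times> real) set"
  defines "Q \<equiv> {0..1} \<times> {0..1}"
  assumes "closed S" "closed T" "S \<inter> T = {}"
    and bot: "\<And>s. s \<in> {0..1} \<Longrightarrow> (s, 0) \<notin> S"
    and top: "\<And>s. s \<in> {0..1} \<Longrightarrow> (s, 1) \<notin> T"
    and left: "\<And>t. t \<in> {0..1} \<Longrightarrow> (0, t) \<notin> S \<union> T"
    and right: "\<And>t. t \<in> {0..1} \<Longrightarrow> (1, t) \<notin> S \<union> T"
  shows "path_component (Q - (S \<union> T)) (0, 0) (1, 0)"
proof (rule ccontr)
  assume sep: "\<not> path_component (Q - (S \<union> T)) (0, 0) (1, 0)"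
  define U where "U = Q - (S \<union> T)"
  define C where "C = path_component_set U (0, 0)"
  have Qconv: "convex Q"
    unfolding Q_def by (intro convex_Times) auto
  have lpc: "locally path_connected Q"
    using Qconv convex_imp_locally_path_connected by blast
  have U: "openin (top_of_set Q) U"
    unfolding U_def Diff_eq using assms by (intro openin_open_Int) auto
  have pU: "(0, t) \<in> U" "(1, t) \<in> U" if "t \<in> {0..1}" for t
    using left[OF that] right[OF that] that by (auto simp: U_def Q_def)
  \<comment> \<open>\<open>C\<close> and \<open>U - C\<close> are both relatively open, so different
    formulas for \<open>f\<close> may be chosen on them.\<close>
  have opC: "openin (top_of_set Q) C"
    unfolding C_def by (rule locally_path_connected_2[OF lpc U]) (simp add: pU)
  have opD: "openin (top_of_set Q) (U - C)"
  proof -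
    have "openin (top_of_set Q) (path_component_set U z)" if "z \<in> U - C" for z
      by (rule locally_path_connected_2[OF lpc U]) (use that in simp)
    moreover have "U - C = (\<Union>z\<in>U - C. path_component_set U z)"
    proof
      show "U - C \<subseteq> (\<Union>z\<in>U - C. path_component_set U z)"
        by (auto simp: path_component_refl)
      show "(\<Union>z\<in>U - C. path_component_set U z) \<subseteq> U - C"
        unfolding C_def by (auto dest: path_component_mem path_component_sym path_component_trans)
    qed
    ultimately show ?thesis
      by (metis (no_types, lifting) imageE openin_Union)
  qed
  \<comment> \<open>The vertical sides avoid \<open>S \<union> T\<close>, so the left one lies
    wholly in \<open>C\<close> and the right one wholly outside it.\<close>
  have vC: "(0, t) \<in> C" if "t \<in> {0..1}" for t
  proof -
    have "path_component ({0} \<times> {0..1}) (0 :: real, 0 :: real) (0, t)"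
      using convex_imp_path_connected[of "{0::real} \<times> {0..1::real}"] that
      by (auto simp: path_connected_component convex_Times)
    then have "path_component U (0, 0) (0, t)"
      by (rule path_component_of_subset[rotated]) (use pU in auto)
    then show ?thesis
      by (simp add: C_def)
  qed
  have vD: "(1, t) \<notin> C" if "t \<in> {0..1}" for t
  proof
    assume "(1, t) \<in> C"
    then have 1: "path_component U (0, 0) (1, t)"
      by (simp add: C_def)
    have "path_component ({1} \<times> {0..1}) (1 :: real, t) (1, 0 :: real)"
      using convex_imp_path_connected[of "{1::real} \<times> {0..1::real}"] that
      by (auto simp: path_connected_component convex_Times)
    then have "path_component U (1, t) (1, 0)"
      by (rule path_component_of_subset[rotated]) (use pU in auto)
    with 1 sep show False
      unfolding U_def using path_component_trans by blast
  qed
  \<comment> \<open>The strong form of Urysohn's lemma is used: the values 0 and 1 are attained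
    exactly on \<open>S\<close> and \<open>T\<close>, so off these sets
    \<open>sin (pi * u z)\<close> is positive.\<close>
  obtain u :: "real \<times> real \<Rightarrow> real" where u: "continuous_on UNIV u" "\<And>z. u z \<in> closed_segment 0 1"
    "\<And>z. u z = 0 \<longleftrightarrow> z \<in> S" "\<And>z. u z = 1 \<longleftrightarrow> z \<in> T"
    by (rule Urysohn_strong[OF \<open>closed S\<close> \<open>closed T\<close> \<open>S \<inter> T = {}\<close>, of "0::real" 1]) auto
  have u01: "0 \<le> u z" "u z \<le> 1" for z
    using u(2)[of z] by (auto simp: closed_segment_eq_real_ivl)
  have contu: "continuous_on A u" for A
    using u(1) continuous_on_subset by blast
  text \<open>\<open>f\<close> equals 1 only on \<open>S\<close> and \<open>-1\<close> only on \<open>T\<close>. Hence its argument passes from the upper to the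
    lower half circle through \<open>\<pi>\<close> along the bottom edge and through \<open>0\<close> along the top edge,
    which is impossible since \<open>f\<close> has a continuous logarithm on the square.\<close>
  define f where "f = (\<lambda>z. if z \<in> C then cis (pi * u z) else cis (- (pi * u z)))"
  have Qeq: "(Q - (U - C)) \<union> (Q - C) = Q"
    by blast
  \<comment> \<open>The two closed pieces overlap inside \<open>S \<union> T\<close>; there
    \<open>u\<close> is 0 or 1, and both branches give 1 or both give -1.\<close>
  have "continuous_on ((Q - (U - C)) \<union> (Q - C)) f"
    unfolding f_def
  proof (rule continuous_on_cases_local)
    show "closedin (top_of_set (Q - (U - C) \<union> (Q - C))) (Q - (U - C))"
      "closedin (top_of_set (Q - (U - C) \<union> (Q - C))) (Q - C)"
      unfolding Qeq using opC opD by (metis closedin_diff closedin_topspace topspace_euclidean_subtopology)+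
    fix z assume "z \<in> Q - (U - C) \<and> z \<notin> C \<or> z \<in> Q - C \<and> z \<in> C"
    then have "z \<in> S \<union> T"
      by (auto simp: U_def)
    then have "u z = 0 \<or> u z = 1"
      using u by auto
    then show "cis (pi * u z) = cis (- (pi * u z))"
      by (auto simp: complex_eq_iff)
  qed (intro continuous_intros contu)+
  then have "continuous_on Q f"
    by (simp only: Qeq)
  moreover have "f z \<noteq> 0" for z
    by (simp add: f_def)
  ultimately obtain g where g: "continuous_on Q g" "\<And>z. z \<in> Q \<Longrightarrow> f z = exp (g z)"
    by (rule continuous_logarithm_on_contractible[OF _ convex_imp_contractible[OF Qconv]]) metis
  \<comment> \<open>Subtracting whole turns normalizes the argument \<open>\<theta>\<close> of
    \<open>f\<close> to lie between 0 and \<open>2 * pi\<close> at the corner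
    \<open>(0, 0)\<close>.\<close>
  define k where "k = \<lfloor>Im (g (0, 0)) / (2 * pi)\<rfloor>"
  define \<theta> where "\<theta> = (\<lambda>z. Im (g z) - 2 * pi * of_int k)"
  have \<theta>: "continuous_on Q \<theta>"
    unfolding \<theta>_def by (intro continuous_intros g)
  have k: "0 \<le> \<theta> (0, 0)" "\<theta> (0, 0) < 2 * pi"
  proof -
    have "of_int k \<le> Im (g (0, 0)) / (2 * pi)" "Im (g (0, 0)) / (2 * pi) < of_int k + 1"
      unfolding k_def by linarith+
    then have "of_int k * (2 * pi) \<le> Im (g (0, 0))" "Im (g (0, 0)) < (of_int k + 1) * (2 * pi)"
      by (simp_all add: pos_le_divide_eq pos_divide_less_eq)
    then show "0 \<le> \<theta> (0, 0)" "\<theta> (0, 0) < 2 * pi"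
      by (simp_all add: \<theta>_def algebra_simps)
  qed
  have fcis: "f z = cis (\<theta> z)" if "z \<in> Q" for z
  proof -
    have "norm (exp (g z)) = 1"
      unfolding g(2)[OF that, symmetric] by (simp add: f_def)
    then have "Re (g z) = 0"
      by (simp add: norm_exp_eq_Re)
    then have "f z = cis (Im (g z))"
      using g(2)[OF that] by (simp add: exp_eq_polar)
    also have "\<dots> = cis (\<theta> z)"
      by (simp add: \<theta>_def cis_multiple_2pi flip: cis_divide)
    finally show ?thesis .
  qed
  have sinC: "sin (\<theta> z) = sin (pi * u z)" if "z \<in> Q" "z \<in> C" for z
    using fcis[OF that(1)] that(2) by (auto simp: f_def complex_eq_iff)
  have sinD: "sin (\<theta> z) = - sin (pi * u z)" if "z \<in> Q" "z \<notin> C" for z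
    using fcis[OF that(1)] that(2) by (auto simp: f_def complex_eq_iff)
  have cos: "cos (\<theta> z) = cos (pi * u z)" if "z \<in> Q" for z
    using fcis[OF that(1)] by (auto simp: f_def complex_eq_iff split: if_splits)
  have sinu: "sin (pi * u z) > 0" if "z \<notin> S \<union> T" for z
  proof -
    have "0 < u z" "u z < 1"
      using u01[of z] u(3,4)[of z] that by (auto simp: less_le)
    then show ?thesis
      by (intro sin_gt_zero) auto
  qed
  have cos1: "cos (\<theta> z) \<noteq> 1" if "z \<in> Q" "z \<notin> S" for z
  proof
    assume "cos (\<theta> z) = 1"
    then have "cos (pi * u z) = cos 0"
      using cos that by simp
    then have "pi * u z = 0"
      using u01[of z] by - (rule cos_inj_pi, auto simp: mult_left_le)
    then show False
      using u(3) that by auto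
  qed
  have cos2: "cos (\<theta> z) \<noteq> -1" if "z \<in> Q" "z \<notin> T" for z
  proof
    assume "cos (\<theta> z) = -1"
    then have "cos (pi * u z) = cos pi"
      using cos that by simp
    then have "pi * u z = pi"
      using u01[of z] by - (rule cos_inj_pi, auto simp: mult_left_le)
    then show False
      using u(4) that by auto
  qed
  have cont: "continuous_on {0..1} (\<lambda>s. \<theta> (s, 0))" "continuous_on {0..1} (\<lambda>s. \<theta> (s, 1))"
      "continuous_on {0..1} (\<lambda>t. \<theta> (0, t))" "continuous_on {0..1} (\<lambda>t. \<theta> (1, t))"
    by (rule continuous_on_compose2[OF \<theta>]; force simp: Q_def intro!: continuous_intros)+
  have QI: "(s, t) \<in> Q" if "s \<in> {0..1}" "t \<in> {0..1}" for s t
    using that by (simp add: Q_def)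
  have lsin: "sin (\<theta> (0, t)) > 0" if "t \<in> {0..1}" for t
    using sinC[of "(0, t)"] sinu[of "(0, t)"] left[OF that] vC[OF that] QI that by auto
  have rsin: "sin (\<theta> (1, t)) < 0" if "t \<in> {0..1}" for t
    using sinD[of "(1, t)"] sinu[of "(1, t)"] right[OF that] vD[OF that] QI that by auto
  have \<theta>00: "\<theta> (0, 0) < pi" "\<theta> (0, 0) > 0"
  proof -
    show "\<theta> (0, 0) < pi"
      using lsin[of 0] k sin_le_zero[of "\<theta> (0, 0)"] by force
    show "\<theta> (0, 0) > 0"
      using lsin[of 0] k by (cases "\<theta> (0, 0) = 0") auto
  qed
  \<comment> \<open>Two routes to \<open>(1, 1)\<close> disagree. Via the left and top sides
    \<open>\<theta>\<close> cannot cross \<open>pi\<close>. Via the bottom side it cannot reach 0,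
    so it exceeds \<open>pi\<close> on the right side, where its sine is negative.\<close>
  have "\<theta> (0, 1) < pi"
    by (rule ivt_avoid_less[OF cont(3)]) (use lsin \<theta>00 in force)+
  then have "\<theta> (1, 1) < pi"
  proof (rule ivt_avoid_less[OF cont(2), rotated])
    fix s :: real assume "s \<in> {0..1}"
    then show "\<theta> (s, 1) \<noteq> pi"
      using cos2[of "(s, 1)"] top[of s] QI[of s 1] by auto
  qed
  moreover have "\<theta> (1, 0) > 0"
  proof (rule ivt_avoid_greater[OF cont(1) _ \<theta>00(2)])
    fix s :: real assume "s \<in> {0..1}"
    then show "\<theta> (s, 0) \<noteq> 0"
      using cos1[of "(s, 0)"] bot[of s] QI[of s 0] by auto
  qed
  then have "\<theta> (1, 0) > pi"
    using rsin[of 0] sin_ge_zero[of "\<theta> (1, 0)"] by force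
  then have "\<theta> (1, 1) > pi"
    by (rule ivt_avoid_greater[OF cont(4), rotated]) (use rsin in force)
  ultimately show False
    by simp
qed

text \<open>The straight-line homotopy \<open>H\<close> from a path avoiding \<open>S\<close> to a
  path avoiding \<open>T\<close> reduces this to the square: the bottom edge traces the first path,
  the top edge the second, and the vertical sides stay at \<open>x\<close> and \<open>y\<close>. The
  path found in the square is mapped back by \<open>H\<close>.\<close>

lemma path_component_Euclidean_space_Diff_Un:
  fixes S T :: "(nat \<Rightarrow> real) set" and n :: nat
  defines "E \<equiv> topspace (Euclidean_space n)"
  assumes "closed S" "closed T" "S \<inter> T = {}"
    and S: "path_component (E - S) x y" and T: "path_component (E - T) x y"
  shows "path_component (E - (S \<union> T)) x y"
proof -
  obtain \<alpha> where \<alpha>: "path \<alpha>" "path_image \<alpha> \<subseteq> E - S" "pathstart \<alpha> = x" "pathfinish \<alpha> = y"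
    using S unfolding path_component_def by blast
  obtain \<beta> where \<beta>: "path \<beta>" "path_image \<beta> \<subseteq> E - T" "pathstart \<beta> = x" "pathfinish \<beta> = y"
    using T unfolding path_component_def by blast
  define Q where "Q = {0..1::real} \<times> {0..1::real}"
  define H where "H = (\<lambda>(s, t) i. (1 - t) * \<alpha> s i + t * \<beta> s i)"
  have fst: "continuous_on Q fst" "fst ` Q \<subseteq> {0..1}"
    by (auto simp: Q_def intro: continuous_on_fst continuous_on_id)
  have "continuous_on Q (\<lambda>z. \<alpha> (fst z))"
    by (rule continuous_on_compose2[OF _ fst]) (use \<alpha> in \<open>simp add: path_def\<close>)
  moreover have "continuous_on Q (\<lambda>z. \<beta> (fst z))"
    by (rule continuous_on_compose2[OF _ fst]) (use \<beta> in \<open>simp add: path_def\<close>)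
  ultimately have "continuous_on Q (\<lambda>z. \<alpha> (fst z) i)" "continuous_on Q (\<lambda>z. \<beta> (fst z) i)" for i
    by (auto intro: continuous_on_product_then_coordinatewise)
  then have H: "continuous_on Q H"
    unfolding H_def case_prod_beta
    by (intro continuous_on_coordinatewise_then_product continuous_on_add continuous_on_mult
          continuous_on_diff continuous_on_const continuous_on_snd continuous_on_id)
  have \<alpha>E: "\<alpha> s \<in> E - S" and \<beta>E: "\<beta> s \<in> E - T" if "s \<in> {0..1}" for s
    using \<alpha>(2) \<beta>(2) that by (auto simp: path_image_def image_subset_iff)
  have HE: "H z \<in> E" if "z \<in> Q" for z
    using that \<alpha>E[of "fst z"] \<beta>E[of "fst z"]
    by (auto simp: E_def topspace_Euclidean_space H_def Q_def case_prod_beta mem_Times_iff)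
  have "closed Q"
    unfolding Q_def by (intro closed_Times) auto
  then have cl: "closed (Q \<inter> H -` S)" "closed (Q \<inter> H -` T)"
    using H assms by (auto intro: continuous_closed_preimage)
  have Hb: "H (s, 0) = \<alpha> s" "H (s, 1) = \<beta> s" for s
    by (auto simp: H_def)
  have Hl: "H (0, t) = x" "H (1, t) = y" for t
    using \<alpha> \<beta> by (auto simp: H_def pathstart_def pathfinish_def algebra_simps)
  have xy: "x \<notin> S \<union> T" "y \<notin> S \<union> T"
    using S T path_component_mem by blast+
  have "path_component (Q - ((Q \<inter> H -` S) \<union> (Q \<inter> H -` T))) (0, 0) (1, 0)"
    unfolding Q_def
    by (rule path_component_square_Diff_Un[OF cl[unfolded Q_def]])
       (use assms \<alpha>E \<beta>E xy in \<open>auto simp: Hb Hl\<close>)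
  then obtain p where p: "path p" "path_image p \<subseteq> Q - ((Q \<inter> H -` S) \<union> (Q \<inter> H -` T))"
      "pathstart p = (0, 0)" "pathfinish p = (1, 0)"
    unfolding path_component_def by blast
  have "path (H \<circ> p)"
    using p(2) by (intro path_continuous_image p continuous_on_subset[OF H]) auto
  moreover have "path_image (H \<circ> p) \<subseteq> E - (S \<union> T)"
    using p(2) HE by (fastforce simp: path_image_compose)
  ultimately show ?thesis
    unfolding path_component_def
    using p Hl by (intro exI[of _ "H \<circ> p"]) (auto simp: pathstart_compose pathfinish_compose)
qed

subsection \<open>Hypersurfaces with a hole\<close>

text \<open>\<open>Euclidean_space n\<close> consists of the sequences vanishing from coordinate
  \<open>n\<close> on; as a subspace of the type \<open>nat \<Rightarrow> real\<close> it gives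
  access to the type-class notions of path, closed set and metric.\<close>

lemma Euclidean_space_eq_top_of_set: "Euclidean_space n = top_of_set (topspace (Euclidean_space n))"
  by (simp add: Euclidean_space_def euclidean_product_topology)

lemma path_connected_topspace_Euclidean_space: "path_connected (topspace (Euclidean_space n))"
proof -
  have "path_connectedin (top_of_set (topspace (Euclidean_space n))) (topspace (Euclidean_space n))"
    using path_connected_Euclidean_space[of n]
    by (metis Euclidean_space_eq_top_of_set path_connectedin_topspace)
  then show ?thesis
    by (simp add: path_connectedin_subtopology)
qed

lemma continuous_on_fun_upd:
  fixes g :: "'a::topological_space \<Rightarrow> 'i \<Rightarrow> 'b::topological_space"
  assumes "continuous_on A g" "continuous_on A h"
  shows "continuous_on A (\<lambda>a. (g a)(m := h a))"
proof (rule continuous_on_coordinatewise_then_product)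
  fix i
  show "continuous_on A (\<lambda>a. ((g a)(m := h a)) i)"
    using assms continuous_on_product_then_coordinatewise[of A g i] by (cases "i = m") auto
qed

lemma path_component_image_path_connected:
  assumes "path_connected A" "continuous_on A f" "f ` A \<subseteq> C" "a \<in> A" "b \<in> A"
  shows "path_component C (f a) (f b)"
  using path_connected_continuous_image[OF assms(2,1)] assms(3-)
  by (meson imageI path_component_of_subset path_connected_component)

text \<open>The removed set is the graph of \<open>1 / d\<close> over \<open>V\<close> with a hole
  above \<open>G\<close>. Points below it, or on a vertical line over \<open>G\<close>, move to
  height -1, which is free since \<open>d\<close> is nonnegative; points above it slide over
  \<open>V\<close> to the hole and then drop through it.\<close>

lemma path_connected_Euclidean_space_Diff_graph:
  fixes d :: "(nat \<Rightarrow> real) \<Rightarrow> real"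
  assumes V: "path_connected V" "V \<subseteq> topspace (Euclidean_space m)"
    and G: "G \<noteq> {}" "G \<subseteq> V"
    and d: "continuous_on (topspace (Euclidean_space m)) d"
      "\<And>x. x \<in> topspace (Euclidean_space m) \<Longrightarrow> 0 \<le> d x"
      "\<And>x. x \<in> topspace (Euclidean_space m) \<Longrightarrow> d x = 0 \<longleftrightarrow> x \<notin> V"
  shows "path_connected (topspace (Euclidean_space (Suc m)) -
           {z. z m * d (z(m := 0)) = 1 \<and> z(m := 0) \<notin> G})" (is "path_connected ?C")
proof -
  define E where "E = topspace (Euclidean_space m)"
  have inC: "x(m := t) \<in> ?C" if "x \<in> E" "t * d x \<noteq> 1 \<or> x \<in> G" for x t
  proof -
    have "x(m := 0) = x"
      using that by (auto simp: E_def topspace_Euclidean_space)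
    then show ?thesis
      using that by (auto simp: E_def topspace_Euclidean_space)
  qed
  have low: "path_component ?C (x(m := -1)) (x'(m := -1))" if "x \<in> E" "x' \<in> E" for x x'
  proof -
    have "path_connected E"
      unfolding E_def by (rule path_connected_topspace_Euclidean_space)
    then show ?thesis
    proof (rule path_component_image_path_connected[where f = "\<lambda>x. x(m := -1)"])
      show "(\<lambda>x. x(m := -1)) ` E \<subseteq> ?C"
      proof (intro image_subsetI inC)
        fix x assume "x \<in> E"
        then have "0 \<le> d x"
          by (simp add: E_def d)
        then show "-1 * d x \<noteq> 1 \<or> x \<in> G"
          by auto
      qed
      show "continuous_on E (\<lambda>x. x(m := -1))"
        by (rule continuous_on_fun_upd[OF continuous_on_id continuous_on_const])
    qed (use that in auto)
  qed
  have vert: "path_component ?C (x(m := t)) (x(m := -1))" if x: "x \<in> E" and tx: "t * d x < 1 \<or> x \<in> G" for x t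
  proof -
    show ?thesis
    proof (rule path_component_image_path_connected)
      show "(\<lambda>s. x(m := s)) ` {min t (-1)..max t (-1)} \<subseteq> ?C"
      proof (intro image_subsetI inC x)
        fix s assume "s \<in> {min t (-1)..max t (-1)}"
        moreover have "0 \<le> d x"
          using x by (simp add: E_def d)
        ultimately have "s * d x \<le> max (t * d x) (-1 * d x)"
          by (metis atLeastAtMost_iff le_max_iff_disj mult_right_mono)
        then show "s * d x \<noteq> 1 \<or> x \<in> G"
          using tx \<open>0 \<le> d x\<close> by auto
      qed
      show "continuous_on {min t (-1)..max t (-1)} (\<lambda>s. x(m := s))"
        by (rule continuous_on_fun_upd[OF continuous_on_const continuous_on_id])
    qed (auto intro: convex_imp_path_connected)
  qed
  obtain o' where o': "o' \<in> G"
    using G by blast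
  have "path_component ?C z (o'(m := -1))" if "z \<in> ?C" for z
  proof -
    define x where "x = z(m := 0)"
    define t where "t = z m"
    have x: "x \<in> E"
      using that unfolding x_def E_def topspace_Euclidean_space by (auto simp: Suc_le_eq)
    have z: "z = x(m := t)"
      by (simp add: x_def t_def)
    have o'E: "o' \<in> E"
      using o' G V by (auto simp: E_def)
    show ?thesis
    proof (cases "t * d x < 1 \<or> x \<in> G")
      case True
      then show ?thesis
        unfolding z using vert[OF x True] low[OF x o'E] path_component_trans by blast
    next
      case False
      then have gt: "t * d x > 1"
        using that by (auto simp: x_def t_def)
      then have "d x \<noteq> 0"
        by auto
      then have "x \<in> V"
        using d(3)[of x] x by (auto simp: E_def)
      have dV: "d v \<noteq> 0" "v \<in> E" if "v \<in> V" for v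
        using d(3)[of v] V that by (auto simp: E_def)
      have "continuous_on V d"
        using d(1) V continuous_on_subset by blast
      \<comment> \<open>At height \<open>t * d x / d v\<close> the product with \<open>d v\<close>
        keeps the constant value \<open>t * d x > 1\<close>, so the slide from \<open>x\<close> to
        \<open>o'\<close> stays above the graph.\<close>
      have "path_component ?C (x(m := t * d x / d x)) (o'(m := t * d x / d o'))"
      proof (rule path_component_image_path_connected[OF V(1), where f = "\<lambda>v. v(m := t * d x / d v)"])
        show "(\<lambda>v. v(m := t * d x / d v)) ` V \<subseteq> ?C"
          by (intro image_subsetI inC) (use dV gt in auto)
        show "continuous_on V (\<lambda>v. v(m := t * d x / d v))"
          using \<open>continuous_on V d\<close> dV
          by (intro continuous_on_fun_upd continuous_on_id continuous_on_divide continuous_on_const) auto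
      qed (use \<open>x \<in> V\<close> o' G in auto)
      then have "path_component ?C (x(m := t)) (o'(m := t * d x / d o'))"
        using \<open>d x \<noteq> 0\<close> by simp
      moreover have "path_component ?C (o'(m := t * d x / d o')) (o'(m := -1))"
        using vert o'E o' by blast
      ultimately show ?thesis
        unfolding z using path_component_trans by blast
    qed
  qed
  then show ?thesis
    unfolding path_connected_component by (meson path_component_sym path_component_trans)
qed

text \<open>\<open>K\<close> may be embedded wildly, but path-connectedness of the complement of a
  closed set in Euclidean space depends only on the homeomorphism type of the set. So
  \<open>K\<close> is traded for the closed graph \<open>L\<close>, whose hole over \<open>G\<close>
  gives access from one side to the other.\<close>

proposition path_connected_Euclidean_space_Diff_hypersurface:
  assumes V: "openin (Euclidean_space m) V" "path_connected V"
    and G: "openin (Euclidean_space m) G" "G \<noteq> {}" "G \<subseteq> V"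
    and K: "closedin (Euclidean_space (Suc m)) K"
    and hom: "subtopology (Euclidean_space (Suc m)) K homeomorphic_space subtopology (Euclidean_space m) (V - G)"
  shows "path_connected (topspace (Euclidean_space (Suc m)) - K)"
proof -
  define E where "E = topspace (Euclidean_space m)"
  define F where "F = topspace (Euclidean_space (Suc m))"
  have top: "Euclidean_space m = top_of_set E" "Euclidean_space (Suc m) = top_of_set F"
    unfolding E_def F_def by (rule Euclidean_space_eq_top_of_set)+
  obtain W where W: "open W" "V = E \<inter> W"
    using V(1) unfolding top openin_open by blast
  \<comment> \<open>\<open>infdist\<close> to the empty set is 0, so the case
    \<open>W = UNIV\<close> needs its own positive value.\<close>
  define d where "d = (\<lambda>x. if W = UNIV then 1 else infdist x (- W))"
  have d: "continuous_on A d" "0 \<le> d x" for A x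
    unfolding d_def by (cases "W = UNIV"; simp add: continuous_on_infdist continuous_on_id infdist_nonneg)+
  have d0: "d x = 0 \<longleftrightarrow> x \<notin> W" for x
    using in_closed_iff_infdist_zero[of "- W" x] W(1) unfolding d_def by (auto simp: closed_Compl)
  have dpos: "d x > 0" if "x \<in> V" for x
    using d(2)[of x] d0[of x] that W by auto
  text \<open>\<open>d\<close> vanishes exactly off \<open>V\<close>, so the graph of \<open>1 / d\<close> is a closed copy of \<open>V\<close>.\<close>
  define L where "L = {z \<in> F. z m * d (z(m := 0)) = 1 \<and> z(m := 0) \<notin> G}"
  have upd_E: "z(m := 0) \<in> E" if "z \<in> F" for z
    using that unfolding E_def F_def topspace_Euclidean_space by (auto simp: Suc_le_eq)
  have upd_F: "x(m := t) \<in> F" "x(m := 0) = x" if "x \<in> E" for x t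
    using that unfolding E_def F_def topspace_Euclidean_space by auto
  have clL: "closedin (top_of_set F) L"
  proof -
    have "continuous_on F (\<lambda>z. z(m := 0))"
      by (intro continuous_on_fun_upd continuous_on_id continuous_on_const)
    moreover have "closedin (top_of_set E) (E - G)"
      using G(1) top by (metis closedin_def E_def double_diff openin_subset order_refl Diff_subset)
    ultimately have 1: "closedin (top_of_set F) (F \<inter> (\<lambda>z. z(m := 0)) -` (E - G))"
      using upd_E by (auto intro: continuous_closedin_preimage_gen)
    \<comment> \<open>Written as a product, the graph equation is continuous on all of
      \<open>F\<close>, also where \<open>d\<close> vanishes, so \<open>L\<close> is closed even
      over the boundary of \<open>V\<close>.\<close>
    have "continuous_on F (\<lambda>z. z m * d (z(m := 0)))"
      by (intro continuous_on_mult continuous_on_compose2[OF d(1)[of UNIV]] continuous_on_fun_upd continuous_on_id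
            continuous_on_const continuous_on_product_then_coordinatewise) auto
    then have 2: "closedin (top_of_set F) (F \<inter> (\<lambda>z. z m * d (z(m := 0))) -` {1})"
      by (intro continuous_closedin_preimage) auto
    have "L = (F \<inter> (\<lambda>z. z(m := 0)) -` (E - G)) \<inter> (F \<inter> (\<lambda>z. z m * d (z(m := 0))) -` {1})"
      using upd_E by (auto simp: L_def)
    then show ?thesis
      using closedin_Int[OF 1 2] by simp
  qed
  have homL: "top_of_set L homeomorphic_space top_of_set (V - G)"
  proof -
    have L1: "z(m := 0) \<in> V - G" "(z(m := 0))(m := 1 / d (z(m := 0))) = z" if "z \<in> L" for z
    proof -
      have z: "z \<in> F" "z m * d (z(m := 0)) = 1" "z(m := 0) \<notin> G"
        using that by (auto simp: L_def)
      then have "d (z(m := 0)) \<noteq> 0"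
        by auto
      then show "z(m := 0) \<in> V - G"
        using d0 upd_E[OF z(1)] W z(3) by blast
      have "z m = 1 / d (z(m := 0))"
        using z(2) \<open>d (z(m := 0)) \<noteq> 0\<close> by (metis nonzero_eq_divide_eq)
      then show "(z(m := 0))(m := 1 / d (z(m := 0))) = z"
        by (metis fun_upd_triv fun_upd_upd)
    qed
    have L2: "x(m := 1 / d x) \<in> L" "x(m := 1 / d x, m := 0) = x" if "x \<in> V - G" for x
    proof -
      have "x \<in> E" "d x > 0"
        using that W dpos by auto
      then show "x(m := 1 / d x, m := 0) = x"
        using upd_F by simp
      then show "x(m := 1 / d x) \<in> L"
        using upd_F(1)[OF \<open>x \<in> E\<close>] that \<open>d x > 0\<close> by (simp add: L_def)
    qed
    have "continuous_on (V - G) (\<lambda>x. 1 / d x)"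
      using dpos by (intro continuous_on_divide continuous_on_const d) force
    then have "continuous_on (V - G) (\<lambda>x. x(m := 1 / d x))"
      by (intro continuous_on_fun_upd continuous_on_id)
    moreover have "continuous_on L (\<lambda>z. z(m := 0))"
      by (intro continuous_on_fun_upd continuous_on_id continuous_on_const)
    ultimately have "homeomorphic_maps (top_of_set L) (top_of_set (V - G)) (\<lambda>z. z(m := 0)) (\<lambda>x. x(m := 1 / d x))"
      unfolding homeomorphic_maps_def using L1 L2 by (simp del: fun_upd_upd)
    then show ?thesis
      unfolding homeomorphic_space_def by blast
  qed
  have "K \<subseteq> F" "L \<subseteq> F" "V - G \<subseteq> E"
    using closedin_subset[OF K] W by (auto simp: F_def L_def)
  then have "subtopology (Euclidean_space (Suc m)) K = top_of_set K"
      "subtopology (Euclidean_space (Suc m)) L = top_of_set L"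
      "subtopology (Euclidean_space m) (V - G) = top_of_set (V - G)"
    unfolding top by (simp_all add: subtopology_subtopology Int_absorb1)
  then have "subtopology (Euclidean_space (Suc m)) K homeomorphic_space subtopology (Euclidean_space (Suc m)) L"
    using hom homL by (metis homeomorphic_space_sym homeomorphic_space_trans)
  then have "path_connectedin (Euclidean_space (Suc m)) (F - K) \<longleftrightarrow> path_connectedin (Euclidean_space (Suc m)) (F - L)"
    unfolding F_def
    by (intro path_connectedin_Euclidean_complements K) (use clL top in simp)
  moreover have "path_connected (F - L)"
  proof -
    have "F - L = F - {z. z m * d (z(m := 0)) = 1 \<and> z(m := 0) \<notin> G}"
      by (auto simp: L_def)
    then show ?thesis
      using path_connected_Euclidean_space_Diff_graph[OF V(2) _ G(2,3) d, of m] d0 W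
      unfolding E_def F_def by auto
  qed
  ultimately show ?thesis
    unfolding top by (simp add: path_connectedin_subtopology)
qed

subsection \<open>Local accessibility of hypersurfaces\<close>

text \<open>\<open>W\<close> does not depend on \<open>q\<close>, \<open>N\<close> or
  \<open>x\<close>. This uniformity later makes the set of points of \<open>Y\<close> in the closure
  of a component open in \<open>Y\<close>, and allows a single point to be approached through
  shrinking neighbourhoods.\<close>

proposition Euclidean_hypersurface_local_accessibility:
  assumes Z: "closedin (Euclidean_space (Suc m)) Z" and \<Omega>: "openin (Euclidean_space m) \<Omega>"
    and hom: "subtopology (Euclidean_space (Suc m)) Z homeomorphic_space subtopology (Euclidean_space m) \<Omega>"
    and p: "p \<in> Z"
  obtains W where "openin (Euclidean_space (Suc m)) W" "p \<in> W"
    "\<And>q N x. \<lbrakk>q \<in> Z \<inter> W; openin (Euclidean_space (Suc m)) N; q \<in> N; x \<in> W - Z\<rbrakk>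
      \<Longrightarrow> \<exists>x' \<in> N. path_component (topspace (Euclidean_space (Suc m)) - Z) x x'"
proof -
  define E where "E = topspace (Euclidean_space m)"
  define F where "F = topspace (Euclidean_space (Suc m))"
  have top: "Euclidean_space m = top_of_set E" "Euclidean_space (Suc m) = top_of_set F"
    unfolding E_def F_def by (rule Euclidean_space_eq_top_of_set)+
  have lpc: "locally_path_connected_space (top_of_set S)"
    if "openin (top_of_set E) S \<or> openin (top_of_set F) S" for S
    using that locally_path_connected_space_open_subset[OF locally_path_connected_Euclidean_space]
    unfolding top[symmetric]
    by (metis openin_subset subtopology_subtopology top inf.absorb_iff2 E_def F_def)
  have pco: "path_component_of (top_of_set S) a = path_component S a" for S and a :: "nat \<Rightarrow> real"
    by (rule ext) simp
  have clF: "closed S" if "closedin (top_of_set F) S" for S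
    using closedin_Euclidean_imp_closed that top by metis
  have sub: "Z \<subseteq> F" "\<Omega> \<subseteq> E"
    using closedin_subset[OF Z] openin_subset[OF \<Omega>] by (auto simp: E_def F_def)
  then have "subtopology (Euclidean_space (Suc m)) Z = top_of_set Z"
      "subtopology (Euclidean_space m) \<Omega> = top_of_set \<Omega>"
    unfolding top by (simp_all add: subtopology_subtopology Int_absorb1)
  then obtain g g' where gg': "homeomorphic_maps (top_of_set Z) (top_of_set \<Omega>) g g'"
    using hom unfolding homeomorphic_space_def by auto
  then have g: "continuous_on Z g" "g \<in> Z \<rightarrow> \<Omega>" and g': "continuous_on \<Omega> g'" "g' \<in> \<Omega> \<rightarrow> Z"
    and inv: "\<And>z. z \<in> Z \<Longrightarrow> g' (g z) = z" "\<And>v. v \<in> \<Omega> \<Longrightarrow> g (g' v) = v"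
    by (auto simp: homeomorphic_maps_def)
  \<comment> \<open>The hole argument needs a path-connected parameter domain, hence the component
    of \<open>g p\<close>. As \<open>\<Omega>\<close> is locally path connected, the component is
    open and closed in \<open>\<Omega>\<close>, so \<open>Z0\<close> and \<open>Z - Z0\<close> are
    both closed in \<open>F\<close>.\<close>
  define V where "V = path_component_set \<Omega> (g p)"
  have V: "openin (top_of_set \<Omega>) V" "closedin (top_of_set \<Omega>) V" "V \<subseteq> \<Omega>"
    using openin_path_component_of_locally_path_connected_space[of "top_of_set \<Omega>" "g p"]
      closedin_path_component_of_locally_path_connected_space[of "top_of_set \<Omega>" "g p"] lpc[of \<Omega>] \<Omega>
    by (simp_all add: V_def top pco path_component_subset)
  have pcV: "path_connected V"
    unfolding V_def by (rule path_connected_path_component)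
  have oV: "openin (Euclidean_space m) V"
    using V(1) \<Omega> unfolding top by (rule openin_trans)
  define Z0 where "Z0 = Z \<inter> g -` V"
  have Z0: "openin (top_of_set Z) Z0" "closedin (top_of_set Z) Z0"
    unfolding Z0_def using V g by (auto intro: continuous_openin_preimage continuous_closedin_preimage_gen)
  have "closedin (top_of_set F) Z0"
    using Z0(2) Z unfolding top by (rule closedin_trans)
  have "closedin (top_of_set Z) (Z - Z0)"
    using Z0(1) by (metis closedin_diff closedin_topspace topspace_euclidean_subtopology)
  then have Z1: "closedin (top_of_set F) (Z - Z0)"
    using Z unfolding top by (rule closedin_trans)
  have "p \<in> Z0"
    using p g by (auto simp: Z0_def V_def intro!: path_component_refl)
  have "openin (Euclidean_space (Suc m)) (F - (Z - Z0))" "p \<in> F - (Z - Z0)"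
    using Z1 \<open>p \<in> Z0\<close> p sub unfolding top closedin_def by auto
  \<comment> \<open>\<open>W\<close> does not meet \<open>Z - Z0\<close>, so its points are joined
    to each other off that set by paths within \<open>W\<close>.\<close>
  then obtain W where W: "openin (Euclidean_space (Suc m)) W" "path_connectedin (Euclidean_space (Suc m)) W"
      "p \<in> W" "W \<subseteq> F - (Z - Z0)"
    using locally_path_connected_Euclidean_space[of "Suc m"] unfolding locally_path_connected_space by blast
  have pcW: "path_connected W"
    using W(2) by (simp add: top path_connectedin_subtopology)
  show ?thesis
  proof (rule that[OF W(1,3)])
    fix q N x
    assume q: "q \<in> Z \<inter> W" and N: "openin (Euclidean_space (Suc m)) N" "q \<in> N" and x: "x \<in> W - Z"
    have "q \<in> Z0"
      using q W by auto
    \<comment> \<open>Intersecting with \<open>W\<close> ensures that the point to be reached lies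
      in \<open>N\<close> and can also be joined to \<open>x\<close> inside
      \<open>W\<close>.\<close>
    define M where "M = N \<inter> W"
    have M: "openin (top_of_set F) M" "q \<in> M" "M \<subseteq> F"
      using N W q openin_subset[OF N(1)] by (auto simp: M_def top)
    \<comment> \<open>\<open>G\<close> is the hole: the parameters of the part of \<open>Z0\<close>
      inside \<open>M\<close>, so \<open>g\<close> carries \<open>K = Z0 - M\<close> onto
      \<open>V - G\<close>.\<close>
    define G where "G = V \<inter> g' -` M"
    have "openin (top_of_set \<Omega>) (\<Omega> \<inter> g' -` M)"
    proof -
      have "openin (top_of_set Z) (Z \<inter> M)"
        using M sub by (metis openin_subtopology_Int2 subtopology_subtopology inf.absorb2)
      then have "openin (top_of_set \<Omega>) (\<Omega> \<inter> g' -` (Z \<inter> M))"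
        by (rule continuous_openin_preimage[OF g'])
      moreover have "\<Omega> \<inter> g' -` (Z \<inter> M) = \<Omega> \<inter> g' -` M"
        using g' by auto
      ultimately show ?thesis
        by simp
    qed
    then have "openin (top_of_set \<Omega>) G"
      unfolding G_def using V openin_Int[of "top_of_set \<Omega>" V "\<Omega> \<inter> g' -` M"]
      by (metis Int_assoc inf.absorb1)
    then have oG: "openin (Euclidean_space m) G"
      using \<Omega> unfolding top by (rule openin_trans)
    have "g q \<in> G"
      using \<open>q \<in> Z0\<close> M q inv by (auto simp: G_def Z0_def)
    define K where "K = Z0 - M"
    have K: "closedin (Euclidean_space (Suc m)) K"
      unfolding K_def top using \<open>closedin (top_of_set F) Z0\<close> M by (intro closedin_diff)
    have "homeomorphic_maps (subtopology (top_of_set Z) K) (subtopology (top_of_set \<Omega>) (V - G)) g g'"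
      by (rule homeomorphic_maps_subtopologies_alt[OF gg'])
        (use inv g g' V in \<open>auto simp: K_def Z0_def G_def\<close>)
    then have homK: "subtopology (Euclidean_space (Suc m)) K homeomorphic_space subtopology (Euclidean_space m) (V - G)"
    proof -
      have "K \<subseteq> Z" "V - G \<subseteq> \<Omega>"
        using V by (auto simp: K_def Z0_def)
      then show ?thesis
        using \<open>homeomorphic_maps (subtopology (top_of_set Z) K) (subtopology (top_of_set \<Omega>) (V - G)) g g'\<close> sub
        unfolding top homeomorphic_space_def subtopology_subtopology
        by (metis inf.absorb2 subset_trans)
    qed
    have "path_connected (F - K)"
      unfolding F_def
      by (rule path_connected_Euclidean_space_Diff_hypersurface[OF oV pcV oG _ _ K homK])
        (use \<open>g q \<in> G\<close> in \<open>auto simp: G_def\<close>)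
    then have conn: "connected (F - K)"
      by (rule path_connected_imp_connected)
    define C where "C = path_component_set (F - Z0) x"
    have "openin (top_of_set F) (F - Z0)"
      using \<open>closedin (top_of_set F) Z0\<close> by (simp add: closedin_def)
    then have C: "openin (top_of_set (F - Z0)) C" "closedin (top_of_set (F - Z0)) C" "C \<subseteq> F - Z0"
      using openin_path_component_of_locally_path_connected_space[of "top_of_set (F - Z0)" x]
        closedin_path_component_of_locally_path_connected_space[of "top_of_set (F - Z0)" x] lpc
      by (simp_all add: C_def pco path_component_subset)
    have oC: "openin (top_of_set F) C"
      using C(1) \<open>openin (top_of_set F) (F - Z0)\<close> by (rule openin_trans)
    have "openin (top_of_set (F - Z0)) (F - Z0 - C)"
      using C(2) by (simp add: closedin_def)
    then have oD: "openin (top_of_set F) (F - Z0 - C)"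
      using \<open>openin (top_of_set F) (F - Z0)\<close> by (rule openin_trans)
    have "x \<in> C"
      using x W openin_subset[OF W(1)] by (auto simp: C_def F_def Z0_def intro!: path_component_refl)
    \<comment> \<open>\<open>F - K\<close> is the union of \<open>F - Z0\<close> and
      \<open>M\<close>; a path component \<open>C\<close> of \<open>F - Z0\<close> missing
      \<open>M\<close> would be clopen in the connected set \<open>F - K\<close>.\<close>
    have "C \<inter> M \<noteq> {}"
    proof
      assume "C \<inter> M = {}"
      have "openin (top_of_set (F - K)) C"
        by (rule openin_subset_trans[OF oC]) (use C(3) in \<open>auto simp: K_def\<close>)
      moreover have "openin (top_of_set (F - K)) ((F - Z0 - C) \<union> M)"
        by (rule openin_subset_trans[OF openin_Un[OF oD M(1)]]) (use M(3) in \<open>auto simp: K_def\<close>)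
      moreover have "C \<union> ((F - Z0 - C) \<union> M) = F - K" "C \<inter> ((F - Z0 - C) \<union> M) = {}"
        using C(3) M(3) \<open>C \<inter> M = {}\<close> by (auto simp: K_def)
      ultimately show False
        using conn \<open>x \<in> C\<close> \<open>q \<in> M\<close> unfolding connected_openin_eq by blast
    qed
    then obtain x' where x': "x' \<in> C" "x' \<in> M"
      by blast
    have "path_component (F - Z0) x x'"
      using x' by (simp add: C_def)
    moreover have "path_component (F - (Z - Z0)) x x'"
      using pcW x x' W(4) unfolding path_connected_component M_def
      by (meson DiffD1 IntD2 path_component_of_subset)
    \<comment> \<open>Janiszewski's theorem applies to the disjoint closed sets \<open>Z0\<close>
      and \<open>Z - Z0\<close>.\<close>
    ultimately have "path_component (F - (Z0 \<union> (Z - Z0))) x x'"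
      unfolding F_def
      by (intro path_component_Euclidean_space_Diff_Un clF Z1 \<open>closedin (top_of_set F) Z0\<close>) auto
    moreover have "Z0 \<union> (Z - Z0) = Z"
      by (auto simp: Z0_def)
    ultimately show "\<exists>x' \<in> N. path_component (topspace (Euclidean_space (Suc m)) - Z) x x'"
      using x' by (auto simp: M_def F_def)
  qed
qed

section \<open>Euclidean neighbourhoods in manifolds\<close>

lemma Euclidean_space_box_nbhd:
  assumes V: "openin (Euclidean_space n) V" "c \<in> V"
  obtains B where "openin (Euclidean_space n) B" "c \<in> B" "B \<subseteq> V"
    "subtopology (Euclidean_space n) B homeomorphic_space Euclidean_space n"
proof -
  define F where "F = topspace (Euclidean_space n)"
  have top: "Euclidean_space n = top_of_set F"
    unfolding F_def by (rule Euclidean_space_eq_top_of_set)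
  have Fiff: "x \<in> F \<longleftrightarrow> (\<forall>i\<ge>n. x i = 0)" for x
    by (simp add: F_def topspace_Euclidean_space)
  obtain V' where V': "open V'" "V = F \<inter> V'"
    using V(1) unfolding top openin_open by blast
  then have "openin (product_topology (\<lambda>i. euclidean) UNIV) V'" "c \<in> V'"
    using V(2) by (simp_all add: euclidean_product_topology)
  from product_topology_open_contains_basis[OF this]
  obtain J where J: "c \<in> (\<Pi>\<^sub>E i\<in>UNIV. J i)" "\<And>i. open (J i)" "(\<Pi>\<^sub>E i\<in>UNIV. J i) \<subseteq> V'"
    by (metis open_openin)
  have "\<exists>r>0. ball (c i) r \<subseteq> J i" for i
    using J(1,2) by (auto simp: open_contains_ball)
  then obtain r where r: "\<And>i. r i > 0" "\<And>i. ball (c i) (r i) \<subseteq> J i"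
    by metis
  \<comment> \<open>A box suits the product topology: only the finitely many coordinates below
    \<open>n\<close> are constrained, and the others vanish on all of \<open>F\<close>.\<close>
  define B where "B = {x \<in> F. \<forall>i<n. \<bar>x i - c i\<bar> < r i}"
  have cF: "c i = 0" if "i \<ge> n" for i
    using V V' Fiff that by blast
  have coord: "continuous_on A (\<lambda>x. x i)" for A :: "(nat \<Rightarrow> real) set" and i
    by (rule continuous_on_product_then_coordinatewise[OF continuous_on_id])
  have "B = F \<inter> (\<Inter>i<n. (\<lambda>x. \<bar>x i - c i\<bar>) -` {..<r i})"
    by (auto simp: B_def)
  moreover have "open (\<Inter>i<n. (\<lambda>x. \<bar>x i - c i\<bar>) -` {..<r i})"
    by (intro open_INT ballI open_vimage continuous_on_rabs continuous_on_diff continuous_on_const coord) auto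
  ultimately have opB: "openin (Euclidean_space n) B"
    unfolding top by (simp only: openin_open_Int)
  have "B \<subseteq> V"
  proof
    fix x assume x: "x \<in> B"
    have "x i \<in> J i" for i
    proof (cases "i < n")
      case True
      then have "x i \<in> ball (c i) (r i)"
        using x by (auto simp: B_def dist_real_def abs_minus_commute)
      then show ?thesis
        using r by blast
    next
      case False
      then have "x i = c i"
        using x cF Fiff by (auto simp: B_def)
      then show ?thesis
        using J(1) by auto
    qed
    then show "x \<in> V"
      using J(3) x V' by (auto simp: B_def)
  qed
  \<comment> \<open>Each coordinate line is squeezed onto the interval of radius \<open>r i\<close>
    about \<open>c i\<close> by \<open>t / (1 + \<bar>t\<bar>)\<close>, with inverse
    \<open>u / (1 - \<bar>u\<bar>)\<close>; coordinates from \<open>n\<close> on remain 0.\<close>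
  define h where "h = (\<lambda>x i. if i < n then c i + r i * (x i / (1 + \<bar>x i\<bar>)) else 0)"
  define k where "k = (\<lambda>z i. if i < n then ((z i - c i) / r i) / (1 - \<bar>(z i - c i) / r i\<bar>) else 0)"
  have rB: "\<bar>(z i - c i) / r i\<bar> < 1" if "z \<in> B" "i < n" for z i
    using that r(1)[of i] by (auto simp: B_def abs_divide)
  have "continuous_on F h"
    unfolding h_def
  proof (rule continuous_on_coordinatewise_then_product)
    fix i
    have "1 + \<bar>t\<bar> \<noteq> 0" for t :: real
      using abs_ge_zero[of t] by linarith
    then show "continuous_on F (\<lambda>x. if i < n then c i + r i * (x i / (1 + \<bar>x i\<bar>)) else 0)"
      by (cases "i < n") (auto intro!: continuous_on_add continuous_on_mult continuous_on_divide continuous_on_rabs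
        coord continuous_on_const)
  qed
  moreover have "continuous_on B k"
    unfolding k_def
  proof (rule continuous_on_coordinatewise_then_product)
    fix i
    show "continuous_on B (\<lambda>z. if i < n then ((z i - c i) / r i) / (1 - \<bar>(z i - c i) / r i\<bar>) else 0)"
    proof (cases "i < n")
      case True
      have "r i \<noteq> 0"
        using r(1)[of i] by simp
      moreover have "1 - \<bar>(z i - c i) / r i\<bar> \<noteq> 0" if "z \<in> B" for z
        using rB[OF that True] by linarith
      ultimately have "continuous_on B (\<lambda>z. ((z i - c i) / r i) / (1 - \<bar>(z i - c i) / r i\<bar>))"
        by (intro continuous_on_diff continuous_on_divide continuous_on_rabs coord continuous_on_const) auto
      then show ?thesis
        using True by simp
    qed (simp add: continuous_on_const)
  qed
  moreover have "h x \<in> B" if "x \<in> F" for x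
  proof -
    have "r i * \<bar>x i\<bar> < r i * (1 + \<bar>x i\<bar>)" for i
      using r(1)[of i] by (intro mult_strict_left_mono) auto
    then have "\<bar>r i * (x i / (1 + \<bar>x i\<bar>))\<bar> < r i" for i
      using r(1)[of i] abs_ge_zero[of "x i"] by (simp add: abs_mult abs_divide pos_divide_less_eq)
    then show ?thesis
      by (auto simp: B_def h_def Fiff)
  qed
  moreover have "k z \<in> F" for z
    by (simp add: k_def Fiff)
  moreover have "k (h x) = x" if "x \<in> F" for x
  proof
    fix i
    have "t / (1 + \<bar>t\<bar>) / (1 - \<bar>t / (1 + \<bar>t\<bar>)\<bar>) = t" for t :: real
    proof -
      have "1 - \<bar>t / (1 + \<bar>t\<bar>)\<bar> = 1 / (1 + \<bar>t\<bar>)"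
        using abs_ge_zero[of t] by (simp add: abs_divide field_simps)
      then show ?thesis
        using abs_ge_zero[of t] by simp
    qed
    then show "k (h x) i = x i"
      using that r(1)[of i] by (auto simp: k_def h_def Fiff)
  qed
  moreover have "h (k z) = z" if "z \<in> B" for z
  proof
    fix i
    show "h (k z) i = z i"
    proof (cases "i < n")
      case True
      define u where "u = (z i - c i) / r i"
      have "\<bar>u\<bar> < 1"
        using rB[OF that True] by (simp add: u_def)
      then have "1 + \<bar>u / (1 - \<bar>u\<bar>)\<bar> = 1 / (1 - \<bar>u\<bar>)"
        by (simp add: abs_divide field_simps)
      then have "u / (1 - \<bar>u\<bar>) / (1 + \<bar>u / (1 - \<bar>u\<bar>)\<bar>) = u"
        using \<open>\<bar>u\<bar> < 1\<close> by simp
      moreover have "c i + r i * u = z i"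
        using r(1)[of i] by (simp add: u_def)
      ultimately show ?thesis
        using True by (simp add: h_def k_def flip: u_def)
    qed (use that in \<open>auto simp: h_def B_def Fiff\<close>)
  qed
  ultimately have "homeomorphic_maps (top_of_set B) (top_of_set F) k h"
    unfolding homeomorphic_maps_def by simp
  moreover have "subtopology (top_of_set F) B = top_of_set B"
    by (simp add: B_def subtopology_subtopology Int_absorb1)
  ultimately have "subtopology (Euclidean_space n) B homeomorphic_space Euclidean_space n"
    unfolding top homeomorphic_space_def by auto
  moreover have "c \<in> B"
    using r V V' by (auto simp: B_def)
  ultimately show thesis
    using that opB \<open>B \<subseteq> V\<close> by blast
qed

text \<open>A chart in the definition has an arbitrary open set as image; shrinking it to a box
  gives a domain homeomorphic to the whole Euclidean space, where the results on complements of
  closed sets apply.\<close>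

lemma topological_manifold_ball_nbhd:
  assumes X: "topological_manifold n X" and U: "openin X U" "p \<in> U"
  obtains B where "openin X B" "p \<in> B" "B \<subseteq> U" "subtopology X B homeomorphic_space Euclidean_space n"
proof -
  have "p \<in> topspace X"
    using U openin_subset by blast
  then obtain U0 V where U0: "openin X U0" "p \<in> U0" and V: "openin (Euclidean_space n) V"
    and "subtopology X U0 homeomorphic_space subtopology (Euclidean_space n) V"
    using X unfolding topological_manifold_def by blast
  then obtain f g where fg: "homeomorphic_maps (subtopology X U0) (subtopology (Euclidean_space n) V) f g"
    unfolding homeomorphic_space_def by blast
  have ts: "topspace (subtopology X U0) = U0" "topspace (subtopology (Euclidean_space n) V) = V"
    using U0(1) V openin_subset by (auto intro: topspace_subtopology_subset)
  have f: "continuous_map (subtopology X U0) (Euclidean_space n) f" "f \<in> U0 \<rightarrow> V"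
    and g: "continuous_map (subtopology (Euclidean_space n) V) X g" "g \<in> V \<rightarrow> U0"
    and inv: "\<And>x. x \<in> U0 \<Longrightarrow> g (f x) = x" "\<And>v. v \<in> V \<Longrightarrow> f (g v) = v"
    using fg ts unfolding homeomorphic_maps_def continuous_map_in_subtopology by auto
  have "openin (subtopology (Euclidean_space n) V) {v \<in> V. g v \<in> U}"
    using openin_continuous_map_preimage[OF g(1) U(1)] unfolding ts .
  then have "openin (Euclidean_space n) {v \<in> V. g v \<in> U}"
    using V openin_trans_full by blast
  moreover have "f p \<in> {v \<in> V. g v \<in> U}"
    using U0(2) U(2) f inv by auto
  ultimately obtain D where D: "openin (Euclidean_space n) D" "f p \<in> D" "D \<subseteq> {v \<in> V. g v \<in> U}"
    "subtopology (Euclidean_space n) D homeomorphic_space Euclidean_space n"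
    by (rule Euclidean_space_box_nbhd)
  define B where "B = {x \<in> U0. f x \<in> D}"
  have "openin (subtopology X U0) B"
    using openin_continuous_map_preimage[OF f(1) D(1)] unfolding ts B_def .
  then have "openin X B"
    using U0(1) openin_trans_full by blast
  moreover have "p \<in> B" "B \<subseteq> U"
    using U0 D inv by (auto simp: B_def)
  moreover have "homeomorphic_maps (subtopology (subtopology X U0) B)
      (subtopology (subtopology (Euclidean_space n) V) D) f g"
    by (rule homeomorphic_maps_subtopologies_alt[OF fg]) (use D(3) g inv ts in \<open>auto simp: B_def\<close>)
  then have "subtopology X B homeomorphic_space subtopology (Euclidean_space n) D"
  proof -
    have "U0 \<inter> B = B" "V \<inter> D = D"
      using D(3) by (auto simp: B_def)
    then show ?thesis
      using \<open>homeomorphic_maps (subtopology (subtopology X U0) B) (subtopology (subtopology (Euclidean_space n) V) D) f g\<close>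
      unfolding homeomorphic_space_def subtopology_subtopology by auto
  qed
  then have "subtopology X B homeomorphic_space Euclidean_space n"
    using D(4) homeomorphic_space_trans by blast
  ultimately show thesis
    using that by blast
qed

text \<open>A ball \<open>B\<close> is chosen so small that \<open>B \<inter> Y\<close> lies in one
  chart domain of \<open>Y\<close>. Then \<open>B \<inter> Y\<close> corresponds both to a closed
  set \<open>Z\<close> in the Euclidean space of dimension \<open>Suc m\<close> and to an open set
  \<open>\<Omega>\<close> in dimension \<open>m\<close>. The Euclidean result applies, and
  \<open>k\<close> carries its paths back into \<open>B\<close>, hence into
  \<open>U\<close>.\<close>

proposition submanifold_local_accessibility:
  assumes X: "topological_manifold (Suc m) X" and Y: "submanifold m X Y" "closedin X Y"
    and p: "p \<in> Y" and U: "openin X U" "p \<in> U"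
  obtains W where "openin X W" "p \<in> W"
    "\<And>q N x. \<lbrakk>q \<in> Y \<inter> W; openin X N; q \<in> N; x \<in> W - Y\<rbrakk>
      \<Longrightarrow> \<exists>x' \<in> N. path_component_of (subtopology X (U - Y)) x x'"
proof -
  have YX: "Y \<subseteq> topspace X" and Ym: "topological_manifold m (subtopology X Y)"
    using Y by (auto simp: submanifold_def)
  define n where "n = Suc m"
  have "p \<in> topspace (subtopology X Y)"
    using p YX by auto
  then obtain U' V where U': "openin (subtopology X Y) U'" "p \<in> U'" and V: "openin (Euclidean_space m) V"
    and "subtopology (subtopology X Y) U' homeomorphic_space subtopology (Euclidean_space m) V"
    using Ym unfolding topological_manifold_def by blast
  moreover have "U' \<subseteq> Y"
    using openin_subset[OF U'(1)] by auto
  ultimately have "subtopology X U' homeomorphic_space subtopology (Euclidean_space m) V"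
    by (simp add: subtopology_subtopology Int_absorb1)
  then obtain f g where fg: "homeomorphic_maps (subtopology X U') (subtopology (Euclidean_space m) V) f g"
    unfolding homeomorphic_space_def by blast
  have tsU': "topspace (subtopology X U') = U'" and tsV: "topspace (subtopology (Euclidean_space m) V) = V"
    using \<open>U' \<subseteq> Y\<close> YX openin_subset[OF V] by auto
  have g: "continuous_map (subtopology (Euclidean_space m) V) X g" "g \<in> V \<rightarrow> U'"
    and f: "f \<in> U' \<rightarrow> V" and fginv: "\<And>x. x \<in> U' \<Longrightarrow> g (f x) = x" "\<And>v. v \<in> V \<Longrightarrow> f (g v) = v"
    using fg tsU' tsV unfolding homeomorphic_maps_def continuous_map_in_subtopology by auto
  obtain G where G: "openin X G" "U' = G \<inter> Y"
    using U'(1) unfolding openin_subtopology by blast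
  have "openin X (U \<inter> G)" "p \<in> U \<inter> G"
    using U G U'(2) by auto
  with X obtain B where B: "openin X B" "p \<in> B" "B \<subseteq> U \<inter> G"
    and "subtopology X B homeomorphic_space Euclidean_space n"
    unfolding n_def by (rule topological_manifold_ball_nbhd)
  then obtain h k where hk: "homeomorphic_maps (subtopology X B) (Euclidean_space n) h k"
    unfolding homeomorphic_space_def by blast
  define F where "F = topspace (Euclidean_space n)"
  have tsB: "topspace (subtopology X B) = B"
    using openin_subset[OF B(1)] by auto
  have h: "continuous_map (subtopology X B) (Euclidean_space n) h"
    and k: "continuous_map (Euclidean_space n) X k" "k \<in> F \<rightarrow> B"
    and inv: "\<And>x. x \<in> B \<Longrightarrow> k (h x) = x" "\<And>z. z \<in> F \<Longrightarrow> h (k z) = z"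
    using hk unfolding homeomorphic_maps_def continuous_map_in_subtopology F_def tsB by blast+
  have hF: "h \<in> B \<rightarrow> F"
    using continuous_map_funspace[OF h] unfolding tsB F_def .
  define Z where "Z = {z \<in> F. k z \<in> Y}"
  have Z: "closedin (Euclidean_space n) Z"
    unfolding Z_def F_def by (rule closedin_continuous_map_preimage[OF k(1) Y(2)])
  define \<Omega> where "\<Omega> = {v \<in> V. g v \<in> B}"
  have "openin (subtopology (Euclidean_space m) V) \<Omega>"
    using openin_continuous_map_preimage[OF g(1) B(1)] unfolding tsV \<Omega>_def .
  then have \<Omega>: "openin (Euclidean_space m) \<Omega>"
    using V openin_trans_full by blast
  have "homeomorphic_maps (subtopology (subtopology X B) (B \<inter> Y)) (subtopology (Euclidean_space n) Z) h k"
    by (rule homeomorphic_maps_subtopologies_alt[OF hk]) (use hF k(2) inv tsB in \<open>auto simp: Z_def F_def\<close>)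
  then have "subtopology X (B \<inter> Y) homeomorphic_space subtopology (Euclidean_space n) Z"
    unfolding homeomorphic_space_def subtopology_subtopology by (auto simp: Int_absorb1)
  moreover have "homeomorphic_maps (subtopology (subtopology X U') (B \<inter> Y))
      (subtopology (subtopology (Euclidean_space m) V) \<Omega>) f g"
    by (rule homeomorphic_maps_subtopologies_alt[OF fg])
       (use f g fginv tsU' tsV G(2) in \<open>auto simp: \<Omega>_def\<close>)
  then have "subtopology X (B \<inter> Y) homeomorphic_space subtopology (Euclidean_space m) \<Omega>"
  proof -
    have "U' \<inter> (B \<inter> Y) = B \<inter> Y" "V \<inter> \<Omega> = \<Omega>"
      using B(3) G(2) by (auto simp: \<Omega>_def)
    then show ?thesis
      using \<open>homeomorphic_maps (subtopology (subtopology X U') (B \<inter> Y)) (subtopology (subtopology (Euclidean_space m) V) \<Omega>) f g\<close>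
      unfolding homeomorphic_space_def subtopology_subtopology by auto
  qed
  ultimately have hom: "subtopology (Euclidean_space n) Z homeomorphic_space subtopology (Euclidean_space m) \<Omega>"
    using homeomorphic_space_sym homeomorphic_space_trans by blast
  have "h p \<in> Z"
    using B(2) hF inv p by (auto simp: Z_def)
  then obtain W' where W': "openin (Euclidean_space n) W'" "h p \<in> W'"
    "\<And>q N x. \<lbrakk>q \<in> Z \<inter> W'; openin (Euclidean_space n) N; q \<in> N; x \<in> W' - Z\<rbrakk>
      \<Longrightarrow> \<exists>x' \<in> N. path_component (F - Z) x x'"
    using Euclidean_hypersurface_local_accessibility[OF Z[unfolded n_def] \<Omega> hom[unfolded n_def]]
    unfolding n_def F_def by metis
  define W where "W = {x \<in> B. h x \<in> W'}"
  have "openin (subtopology X B) W"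
    using openin_continuous_map_preimage[OF h W'(1)] unfolding tsB W_def .
  then have "openin X W"
    using B(1) openin_trans_full by blast
  moreover have "p \<in> W"
    using B(2) W'(2) by (simp add: W_def)
  moreover have "\<exists>x' \<in> N. path_component_of (subtopology X (U - Y)) x x'"
    if q: "q \<in> Y \<inter> W" and N: "openin X N" "q \<in> N" and x: "x \<in> W - Y" for q N x
  proof -
    have "openin (Euclidean_space n) {z \<in> F. k z \<in> N}"
      unfolding F_def by (rule openin_continuous_map_preimage[OF k(1) N(1)])
    moreover have "h q \<in> Z \<inter> W'" "h q \<in> {z \<in> F. k z \<in> N}" "h x \<in> W' - Z"
      using q N(2) x hF inv by (auto simp: W_def Z_def)
    ultimately obtain z where z: "z \<in> {z \<in> F. k z \<in> N}" "path_component (F - Z) (h x) z"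
      using W'(3) by blast
    have "continuous_map (subtopology (Euclidean_space n) (F - Z)) (subtopology X (U - Y)) k"
      unfolding continuous_map_in_subtopology
      using k B(3) continuous_map_from_subtopology[OF k(1)] by (auto simp: Z_def F_def)
    moreover have "subtopology (Euclidean_space n) (F - Z) = top_of_set (F - Z)"
      by (metis Diff_subset Euclidean_space_eq_top_of_set F_def inf.absorb2 subtopology_subtopology)
    ultimately have "path_component_of (subtopology X (U - Y)) (k (h x)) (k z)"
      using z(2) path_component_of_continuous_image path_component_of_canon_iff by metis
    then show ?thesis
      using z(1) x inv by (auto simp: W_def)
  qed
  ultimately show thesis
    using that by blast
qed

subsection \<open>Accessibility from path components\<close>

text \<open>The \<open>k\<close>-th path is run on the interval from \<open>k\<close> to
  \<open>k + 1\<close>, the half line is compressed to \<open>{0..<1}\<close>, and the value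
  \<open>y\<close> is added at 1. Continuity at 1 comes from \<open>lim\<close>: the tails enter
  every neighbourhood of \<open>y\<close>.\<close>

lemma path_component_of_infinite_concatenation:
  fixes x :: "nat \<Rightarrow> 'a"
  assumes step: "\<And>k. path_component_of (subtopology X (S k)) (x k) (x (Suc k))"
    and y: "y \<in> topspace X"
    and lim: "\<And>U. openin X U \<Longrightarrow> y \<in> U \<Longrightarrow> \<exists>k. \<forall>j\<ge>k. S j \<subseteq> U"
  shows "path_component_of X (x 0) y"
proof -
  obtain g where g: "\<And>k. pathin (subtopology X (S k)) (g k)" "\<And>k. g k 0 = x k" "\<And>k. g k 1 = x (Suc k)"
    using step unfolding path_component_of_def by metis
  have gX: "continuous_map (top_of_set {0..1}) X (g k)" and gS: "t \<in> {0..1} \<Longrightarrow> g k t \<in> S k" for k t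
    using g(1)[of k] unfolding pathin_def continuous_map_in_subtopology by auto
  obtain \<delta> where \<delta>: "continuous_map (top_of_set {0::real..}) X \<delta>"
    and \<delta>g: "\<And>t k. \<lbrakk>k \<in> UNIV; t \<in> topspace (top_of_set {0::real..}) \<inter> {real k..real k + 1}\<rbrakk> \<Longrightarrow> \<delta> t = g k (t - real k)"
  proof (rule pasting_lemma_exists_locally_finite[where X = "top_of_set {0::real..}" and I = UNIV and Y = X
        and T = "\<lambda>k. {real k..real k + 1}" and f = "\<lambda>k t. g k (t - real k)"])
    fix t :: real assume t: "t \<in> topspace (top_of_set {0..})"
    show "\<exists>V. openin (top_of_set {0..}) V \<and> t \<in> V \<and> finite {k \<in> UNIV. {real k..real k + 1} \<inter> V \<noteq> {}}"
    proof (intro exI conjI)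
      show "openin (top_of_set {0..}) ({0..} \<inter> {..<t + 1})"
        by (intro openin_open_Int) auto
      show "t \<in> {0..} \<inter> {..<t + 1}"
        using t by auto
      have "{k \<in> UNIV. {real k..real k + 1} \<inter> ({0..} \<inter> {..<t + 1}) \<noteq> {}} \<subseteq> {..nat \<lceil>t + 1\<rceil>}"
      proof
        fix k assume "k \<in> {k \<in> UNIV. {real k..real k + 1} \<inter> ({0..} \<inter> {..<t + 1}) \<noteq> {}}"
        then have "real k < t + 1"
          by auto
        then show "k \<in> {..nat \<lceil>t + 1\<rceil>}"
          by (simp add: le_nat_iff) linarith
      qed
      then show "finite {k \<in> UNIV. {real k..real k + 1} \<inter> ({0..} \<inter> {..<t + 1}) \<noteq> {}}"
        using finite_subset by blast
    qed
    show "\<exists>k. k \<in> UNIV \<and> t \<in> {real k..real k + 1} \<and> g (nat \<lfloor>t\<rfloor>) (t - real (nat \<lfloor>t\<rfloor>)) = g k (t - real k)"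
      using t by (intro exI[of _ "nat \<lfloor>t\<rfloor>"]) (auto simp: of_nat_nat)
  next
    show "topspace (top_of_set {0::real..}) \<subseteq> (\<Union>k. {real k..real k + 1})"
    proof
      fix t assume "t \<in> topspace (top_of_set {0::real..})"
      then have "t \<in> {real (nat \<lfloor>t\<rfloor>)..real (nat \<lfloor>t\<rfloor>) + 1}"
        by (auto simp: of_nat_nat)
      then show "t \<in> (\<Union>k. {real k..real k + 1})"
        by blast
    qed
  next
    fix k
    show "closedin (top_of_set {0..}) {real k..real k + 1}"
      by (rule closed_subset) auto
    have "continuous_on ({0..} \<inter> {real k..real k + 1}) (\<lambda>t. t - real k)"
      by (intro continuous_intros)
    then have "continuous_map (subtopology (top_of_set {0..}) {real k..real k + 1}) (top_of_set {0..1}) (\<lambda>t. t - real k)"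
      by (auto simp: subtopology_subtopology)
    from continuous_map_compose[OF this gX]
    show "continuous_map (subtopology (top_of_set {0..}) {real k..real k + 1}) X (\<lambda>t. g k (t - real k))"
      unfolding o_def .
  next
    \<comment> \<open>Distinct intervals meet only if consecutive, at the shared integer, where
      \<open>g k 1 = g (Suc k) 0\<close>.\<close>
    fix i j and t :: real
    assume t: "t \<in> topspace (top_of_set {0..}) \<inter> {real i..real i + 1} \<inter> {real j..real j + 1}"
    then have "i = j \<or> (j = Suc i \<and> t = real j) \<or> (i = Suc j \<and> t = real i)"
      by auto
    then show "g i (t - real i) = g j (t - real j)"
      using g(2,3) by auto
  qed metis
  have \<delta>S: "\<exists>j\<ge>k. \<delta> t \<in> S j" if "real k \<le> t" for k t
  proof -
    define j where "j = nat \<lfloor>t\<rfloor>"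
    have t: "t \<ge> 0"
      using that by (meson of_nat_0_le_iff order_trans)
    then have tj: "t \<in> {real j..real j + 1}"
      by (auto simp: j_def of_nat_nat)
    then have "\<delta> t = g j (t - real j)" "t - real j \<in> {0..1}"
      using \<delta>g[of j t] t by auto
    then have "\<delta> t \<in> S j"
      using gS by metis
    moreover have "k \<le> j"
      using that by (simp add: j_def le_nat_floor)
    ultimately show ?thesis
      by blast
  qed
  define \<gamma> where "\<gamma> = (\<lambda>t::real. if t = 1 then y else \<delta> (t / (1 - t)))"
  have "continuous_on {0..<1} (\<lambda>t::real. t / (1 - t))"
    by (intro continuous_intros) auto
  then have "continuous_map (top_of_set {0..<1}) (top_of_set {0..}) (\<lambda>t::real. t / (1 - t))"
    by auto
  from continuous_map_compose[OF this \<delta>]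
  have \<delta>': "continuous_map (top_of_set {0..<1}) X (\<lambda>t. \<delta> (t / (1 - t)))"
    unfolding o_def .
  have "continuous_map (top_of_set {0..1}) X \<gamma>"
    unfolding continuous_map_def
  proof (intro conjI allI impI)
    show "\<gamma> \<in> topspace (top_of_set {0..1}) \<rightarrow> topspace X"
      using \<delta>' y by (auto simp: \<gamma>_def continuous_map_def)
    fix U assume U: "openin X U"
    define V where "V = {t \<in> {0..<1}. \<delta> (t / (1 - t)) \<in> U}"
    have "openin (top_of_set {0..<1::real}) V"
      using openin_continuous_map_preimage[OF \<delta>' U] by (simp add: V_def)
    moreover have "openin (top_of_set {0..1}) {0..<1::real}"
    proof -
      have "{0..<1::real} = {0..1} \<inter> {..<1}"
        by auto
      then show ?thesis
        using openin_open_Int[of "{..<1::real}" "{0..1}"] by simp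
    qed
    ultimately have V: "openin (top_of_set {0..1}) V"
      by (rule openin_trans)
    show "openin (top_of_set {0..1}) {t \<in> topspace (top_of_set {0..1}). \<gamma> t \<in> U}"
    proof (cases "y \<in> U")
      case False
      then have "{t \<in> topspace (top_of_set {0..1}). \<gamma> t \<in> U} = V"
        by (auto simp: V_def \<gamma>_def)
      with V show ?thesis
        by simp
    next
      case True
      then obtain k where k: "\<And>j. j \<ge> k \<Longrightarrow> S j \<subseteq> U"
        using lim U by blast
      \<comment> \<open>The threshold \<open>real k / (1 + real k)\<close> is the preimage of
        \<open>k\<close> under \<open>t / (1 - t)\<close>; beyond it only sets \<open>S j\<close>
        with \<open>j \<ge> k\<close> are visited before \<open>y\<close>.\<close>
      have "\<gamma> t \<in> U" if "t \<in> {0..1}" "t > real k / (1 + real k)" for t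
      proof (cases "t = 1")
        case False
        then have "real k \<le> t / (1 - t)"
          using that by (simp add: field_simps)
        with False show ?thesis
          using \<delta>S[of k "t / (1 - t)"] k by (auto simp: \<gamma>_def)
      qed (use True in \<open>simp add: \<gamma>_def\<close>)
      moreover have "real k / (1 + real k) < 1"
        by simp
      moreover have "V = {t \<in> {0..<1}. \<gamma> t \<in> U}"
        by (auto simp: V_def \<gamma>_def)
      ultimately have "{t \<in> topspace (top_of_set {0..1}). \<gamma> t \<in> U} = V \<union> ({0..1} \<inter> {real k / (1 + real k)<..})"
        by fastforce
      moreover have "openin (top_of_set {0..1}) ({0..1} \<inter> {real k / (1 + real k)<..})"
        by (intro openin_open_Int) auto
      ultimately show ?thesis
        using V by (simp add: openin_Un)
    qed
  qed
  moreover have "\<gamma> 0 = x 0" "\<gamma> 1 = y"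
    using \<delta>g[of 0 0] g(2) by (auto simp: \<gamma>_def)
  ultimately show ?thesis
    unfolding path_component_of_def pathin_def by blast
qed

text \<open>Finite intersections turn an enumerated local base at \<open>y\<close> into a decreasing
  one, so that a whole tail of it, not just one member, enters each neighbourhood.\<close>

lemma first_countable_decseq_nbhds:
  assumes X: "first_countable X" and y: "y \<in> topspace X"
  obtains N :: "nat \<Rightarrow> 'a set" where "\<And>k. openin X (N k)" "\<And>k. y \<in> N k" "decseq N"
    "\<And>U. openin X U \<Longrightarrow> y \<in> U \<Longrightarrow> \<exists>k. N k \<subseteq> U"
proof -
  obtain \<B> where \<B>: "countable \<B>" "\<And>V. V \<in> \<B> \<Longrightarrow> openin X V"
      "\<And>U. openin X U \<Longrightarrow> y \<in> U \<Longrightarrow> \<exists>V \<in> \<B>. y \<in> V \<and> V \<subseteq> U"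
    using X y unfolding first_countable_def by metis
  define \<C> where "\<C> = {V \<in> \<B>. y \<in> V}"
  have \<C>: "countable \<C>" "\<C> \<noteq> {}"
    using \<B>(1) \<B>(3)[OF openin_topspace y] by (auto simp: \<C>_def)
  define e where "e = from_nat_into \<C>"
  have e: "range e = \<C>"
    unfolding e_def using \<C> by (rule range_from_nat_into[OF _ _, rotated])
  define N where "N = (\<lambda>k. \<Inter>i\<le>k. e i)"
  have eN: "openin X (e i)" "y \<in> e i" for i
    using e \<B>(2) by (auto simp: \<C>_def)
  show thesis
  proof
    show "openin X (N k)" for k
      unfolding N_def by (intro openin_INT2) (auto simp: eN)
    show "y \<in> N k" for k
      by (simp add: N_def eN)
    show "decseq N"
      unfolding N_def decseq_def by (meson INF_superset_mono atMost_subset_iff order_refl)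
    fix U assume "openin X U" "y \<in> U"
    then obtain V where "V \<in> \<C>" "V \<subseteq> U"
      using \<B>(3) by (auto simp: \<C>_def)
    then obtain k where "e k \<subseteq> U"
      using e by (metis imageE)
    then show "\<exists>k. N k \<subseteq> U"
      by (intro exI[of _ k]) (auto simp: N_def)
  qed
qed

lemma topological_manifold_imp_locally_path_connected_space:
  assumes "topological_manifold n X"
  shows "locally_path_connected_space X"
  unfolding locally_path_connected_space
proof (intro allI impI)
  fix U p assume "openin X U \<and> p \<in> U"
  then obtain B where B: "openin X B" "p \<in> B" "B \<subseteq> U" "subtopology X B homeomorphic_space Euclidean_space n"
    using topological_manifold_ball_nbhd[OF assms] by metis
  then have "path_connected_space (subtopology X B)"
    using homeomorphic_path_connected_space path_connected_Euclidean_space by blast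
  then have "path_connectedin X B"
    using openin_subset[OF B(1)] by (simp add: path_connectedin_def)
  with B show "\<exists>B. openin X B \<and> path_connectedin X B \<and> p \<in> B \<and> B \<subseteq> U"
    by blast
qed

text \<open>The part of \<open>Y\<close> in the closure is nonempty by connectedness of
  \<open>X\<close>, closed in \<open>Y\<close>, and open in \<open>Y\<close> by local accessibility;
  connectedness of \<open>Y\<close> then makes it everything.\<close>

lemma submanifold_subset_closure_of_path_component:
  assumes X: "topological_manifold (Suc m) X" and Y: "submanifold m X Y" "closedin X Y"
    and conn: "connected_space X" "connectedin X Y" and "Y \<noteq> {}" and x: "x \<in> topspace X - Y"
  shows "Y \<subseteq> X closure_of path_component_of_set (subtopology X (topspace X - Y)) x"
proof -
  define C where "C = path_component_of_set (subtopology X (topspace X - Y)) x"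
  have oXY: "openin X (topspace X - Y)"
    using Y(2) by auto
  then have lpc: "locally_path_connected_space (subtopology X (topspace X - Y))"
    using topological_manifold_imp_locally_path_connected_space[OF X]
    by (rule locally_path_connected_space_open_subset[rotated])
  have "openin (subtopology X (topspace X - Y)) C"
    unfolding C_def by (rule openin_path_component_of_locally_path_connected_space[OF lpc])
  then have oC: "openin X C"
    using oXY openin_trans_full by blast
  have cC: "closedin (subtopology X (topspace X - Y)) C"
    unfolding C_def by (rule closedin_path_component_of_locally_path_connected_space[OF lpc])
  have "x \<in> C"
    using x by (auto simp: C_def path_component_of_refl)
  have CX: "C \<subseteq> topspace X - Y"
    using closedin_subset[OF cC] by auto
  \<comment> \<open>A component whose closure missed \<open>Y\<close> would be a proper nonempty
    clopen subset of \<open>X\<close>.\<close>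
  have "Y \<inter> X closure_of C \<noteq> {}"
  proof
    assume "Y \<inter> X closure_of C = {}"
    then have "X closure_of C \<subseteq> topspace X - Y"
      using closure_of_subset_topspace by fastforce
    then have "X closure_of C \<subseteq> (subtopology X (topspace X - Y)) closure_of C"
      using CX by (simp add: closure_of_subtopology Int_absorb1)
    then have "X closure_of C \<subseteq> C"
      using cC by (metis closure_of_eq)
    then have "closedin X C"
      using CX closure_of_subset_eq by blast
    then have "C = {} \<or> C = topspace X"
      using conn(1) oC by (auto simp: connected_space_clopen_in)
    then show False
      using \<open>x \<in> C\<close> CX \<open>Y \<noteq> {}\<close> closedin_subset[OF Y(2)] by blast
  qed
  moreover have "closedin (subtopology X Y) (Y \<inter> X closure_of C)"
    by (metis closedin_closure_of closedin_subtopology inf_commute)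
  moreover have "openin (subtopology X Y) (Y \<inter> X closure_of C)"
  proof (subst openin_subopen, intro ballI)
    fix p assume p: "p \<in> Y \<inter> X closure_of C"
    have "p \<in> topspace X"
      using p closedin_subset[OF Y(2)] by auto
    then obtain W where W: "openin X W" "p \<in> W"
      "\<And>q N x. \<lbrakk>q \<in> Y \<inter> W; openin X N; q \<in> N; x \<in> W - Y\<rbrakk>
        \<Longrightarrow> \<exists>x' \<in> N. path_component_of (subtopology X (topspace X - Y)) x x'"
      using submanifold_local_accessibility[OF X Y _ openin_topspace] p by (metis IntD1)
    \<comment> \<open>From this one point \<open>z\<close> of \<open>C\<close> in \<open>W\<close>,
      paths off \<open>Y\<close>, hence inside \<open>C\<close>, reach every neighbourhood of every
      \<open>q \<in> Y \<inter> W\<close>.\<close>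
    obtain z where z: "z \<in> C" "z \<in> W"
      using IntD2[OF p] W(1,2) unfolding in_closure_of by blast
    have "Y \<inter> W \<subseteq> X closure_of C"
    proof
      fix q assume q: "q \<in> Y \<inter> W"
      show "q \<in> X closure_of C"
        unfolding in_closure_of
      proof (intro conjI allI impI)
        show "q \<in> topspace X"
          using q closedin_subset[OF Y(2)] by auto
        fix N assume "q \<in> N \<and> openin X N"
        then obtain x' where "x' \<in> N" "path_component_of (subtopology X (topspace X - Y)) z x'"
          using W(3)[OF q, of N z] z CX by auto
        then show "\<exists>x'. x' \<in> C \<and> x' \<in> N"
          using z(1) unfolding C_def by (metis mem_Collect_eq path_component_of_trans)
      qed
    qed
    moreover have "openin (subtopology X Y) (Y \<inter> W)"
      using W(1) by (rule openin_subtopology_Int2)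
    ultimately show "\<exists>T. openin (subtopology X Y) T \<and> p \<in> T \<and> T \<subseteq> Y \<inter> X closure_of C"
      using p W(2) by blast
  qed
  moreover have "connected_space (subtopology X Y)" "topspace (subtopology X Y) = Y"
    using conn(2) closedin_subset[OF Y(2)] by (auto simp: connectedin_def)
  ultimately have "Y \<inter> X closure_of C = Y"
    unfolding connected_space_clopen_in by metis
  then show ?thesis
    unfolding C_def by blast
qed

text \<open>Accessibility is applied with \<open>q = y\<close> throughout. \<open>W k\<close> is the
  good neighbourhood for \<open>N k\<close>, and each next point is required to lie in
  \<open>W (Suc k)\<close>, so the walk can continue, while its paths stay in \<open>N k - Y\<close>
  and shrink to \<open>y\<close>.\<close>

lemma submanifold_accessible_point:
  assumes X: "topological_manifold (Suc m) X" and Y: "submanifold m X Y" "closedin X Y" and "y \<in> Y"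
    and y: "y \<in> X closure_of path_component_of_set (subtopology X (topspace X - Y)) x"
  shows "path_component_of (subtopology X ((topspace X - Y) \<union> {y})) x y"
proof -
  let ?A = "(topspace X - Y) \<union> {y}"
  have yX: "y \<in> topspace X"
    using \<open>y \<in> Y\<close> closedin_subset[OF Y(2)] by auto
  have "first_countable X"
    using X by (simp add: topological_manifold_def second_countable_imp_first_countable)
  then obtain N where N: "\<And>k. openin X (N k)" "\<And>k. y \<in> N k" "decseq N"
    "\<And>U. openin X U \<Longrightarrow> y \<in> U \<Longrightarrow> \<exists>k. N k \<subseteq> U"
    using yX by (rule first_countable_decseq_nbhds) blast
  have "\<exists>W. openin X W \<and> y \<in> W \<and> (\<forall>M x. openin X M \<and> y \<in> M \<and> x \<in> W - Y
        \<longrightarrow> (\<exists>x' \<in> M. path_component_of (subtopology X (N k - Y)) x x'))" for k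
    using submanifold_local_accessibility[OF X Y \<open>y \<in> Y\<close> N(1,2)[of k]] \<open>y \<in> Y\<close> by (metis IntI)
  then obtain W where W: "\<And>k. openin X (W k)" "\<And>k. y \<in> W k"
    "\<And>k M x. \<lbrakk>openin X M; y \<in> M; x \<in> W k - Y\<rbrakk> \<Longrightarrow> \<exists>x' \<in> M. path_component_of (subtopology X (N k - Y)) x x'"
    by metis
  obtain x0 where x0: "path_component_of (subtopology X (topspace X - Y)) x x0" "x0 \<in> W 0"
    using y W(1,2)[of 0] unfolding in_closure_of by auto
  have "x0 \<in> W 0 - Y"
    using x0 path_component_in_topspace by fastforce
  \<comment> \<open>The conjunct for \<open>k = 0\<close> fixes the start of the chosen sequence at
    \<open>x0\<close>, which lies in the path component of \<open>x\<close>.\<close>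
  have "\<exists>s. \<forall>k. (s k \<in> W k - Y \<and> (k = 0 \<longrightarrow> s k = x0)) \<and>
      path_component_of (subtopology X (N k - Y)) (s k) (s (Suc k))"
  proof (rule dependent_nat_choice)
    show "\<exists>z. z \<in> W 0 - Y \<and> ((0::nat) = 0 \<longrightarrow> z = x0)"
      using \<open>x0 \<in> W 0 - Y\<close> by blast
    fix z k assume "z \<in> W k - Y \<and> (k = 0 \<longrightarrow> z = x0)"
    then obtain z' where "z' \<in> W (Suc k)" "path_component_of (subtopology X (N k - Y)) z z'"
      using W by metis
    moreover from this(2) have "z' \<notin> Y"
      using path_component_in_topspace by fastforce
    ultimately show "\<exists>z'. (z' \<in> W (Suc k) - Y \<and> (Suc k = 0 \<longrightarrow> z' = x0)) \<and>
        path_component_of (subtopology X (N k - Y)) z z'"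
      by auto
  qed
  then obtain s where s: "s 0 = x0" "\<And>k. path_component_of (subtopology X (N k - Y)) (s k) (s (Suc k))"
    by blast
  have "path_component_of (subtopology X ?A) (s 0) y"
  proof (rule path_component_of_infinite_concatenation)
    fix k
    have "N k - Y \<subseteq> ?A"
      using openin_subset[OF N(1)] by blast
    then show "path_component_of (subtopology (subtopology X ?A) (N k - Y)) (s k) (s (Suc k))"
      using s(2) by (simp add: subtopology_subtopology Int_absorb1)
  next
    show "y \<in> topspace (subtopology X ?A)"
      using yX by simp
    fix U assume "openin (subtopology X ?A) U" "y \<in> U"
    then obtain T where T: "openin X T" "U = T \<inter> ?A"
      unfolding openin_subtopology by blast
    then obtain k where "N k \<subseteq> T"
      using N(4) \<open>y \<in> U\<close> by blast
    then have "N j - Y \<subseteq> U" if "j \<ge> k" for j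
      using decseqD[OF N(3) that] T openin_subset[OF N(1)[of j]] by blast
    then show "\<exists>k. \<forall>j\<ge>k. N j - Y \<subseteq> U"
      by blast
  qed
  moreover have "path_component_of (subtopology X ?A) x x0"
    using x0(1) by (rule path_component_of_mono) auto
  ultimately show ?thesis
    using s(1) path_component_of_trans by metis
qed

section \<open>Path-connectedness with one point of the hypersurface restored\<close>

theorem corollary6:
  fixes n :: nat and X :: "'a topology" and Y :: "'a set" and y :: 'a
  assumes "n > 1"
    and "topological_manifold n X"
    and "submanifold (n - 1) X Y"
    and "connected_space X" and "topspace X \<noteq> {}"
    and "connectedin X Y" and "Y \<noteq> {}"
    and "closedin X Y"
    and "trivial_group (Hom_group (homology_group 1 X) (integer_mod_group 2))"
    and "y \<in> Y"
  shows "path_connected_space (subtopology X ((topspace X - Y) \<union> {y}))"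
proof -
  obtain m where n: "n = Suc m"
    using \<open>n > 1\<close> by (cases n) auto
  have X: "topological_manifold (Suc m) X" and Y: "submanifold m X Y"
    using assms n by auto
  let ?A = "subtopology X ((topspace X - Y) \<union> {y})"
  have yX: "y \<in> topspace ?A"
    using assms closedin_subset by fastforce
  \<comment> \<open>It suffices to join every point to \<open>y\<close>: the component of a point
    off \<open>Y\<close> accumulates at all of \<open>Y\<close>, in particular at
    \<open>y\<close>.\<close>
  have "path_component_of ?A x y" if "x \<in> topspace ?A" for x
  proof (cases "x = y")
    case False
    then have "x \<in> topspace X - Y"
      using that by auto
    then have "y \<in> X closure_of path_component_of_set (subtopology X (topspace X - Y)) x"
      using submanifold_subset_closure_of_path_component[OF X Y] assms by blast
    then show ?thesis
      by (rule submanifold_accessible_point[OF X Y \<open>closedin X Y\<close> \<open>y \<in> Y\<close>])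
  qed (use yX in \<open>simp add: path_component_of_refl\<close>)
  then show ?thesis
    unfolding path_connected_space_iff_path_component
    by (meson path_component_of_sym path_component_of_trans)
qed

end
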